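(* Let $m\ge 2$ and let $n\ge 3$ be an odd integer. Then $\chi_{la}(A(mK_{n+1},K_2))=\chi_{la}(A(mK_n,K_1)\vee K_1)=n+1$.
   Context: All graphs are finite and simple. For a graph $G$ with $q$ edges, a local antimagic labeling of $G$ is a bijection $g:E(G)\to\{1,2,\ldots,q\}$ such that $g^+(u)\neq g^+(v)$ for every edge $uv\in E(G)$, where $g^+(u)$ is the sum of $g(e)$ over all edges $e$ incident to $u$. The local antimagic chromatic number $\chi_{la}(G)$ is the minimum, over all local antimagic labelings $g$ of $G$, of the number of distinct values of $g^+$ on $V(G)$. (It is known that every connected graph of order at least 3 has a local antimagic labeling.) For a graph $G$, $G\vee K_1$ is the graph obtained from $G$ by joining a new vertex to every vertex of $G$. For $m\ge 2$ and $n>r\ge 1$, $A(mK_n,K_r)$ denotes the amalgamation of $m$ copies of the complete graph $K_n$ over $K_r$: the simple graph obtained from $m$ copies of $K_n$ by choosing a $K_r$ in each copy and identifying these $m$ copies of $K_r$ into a single $K_r$. Equivalently, it is the join $(mK_{n-r})\vee K_r$, where $mK_{n-r}$ is the disjoint union of $m$ copies of $K_{n-r}$. *)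

theory Defs
  imports Main
begin

record 'a graph =
  verts :: "'a set"
  edges :: "'a set set"

definition simple_graph :: "'a graph \<Rightarrow> bool" where
  "simple_graph G \<longleftrightarrow> finite (verts G) \<and> (\<forall>e\<in>edges G. e \<subseteq> verts G \<and> card e = 2)"

definition map_graph :: "('a \<Rightarrow> 'b) \<Rightarrow> 'a graph \<Rightarrow> 'b graph" where
  "map_graph f G = \<lparr>verts = f ` verts G, edges = (`) f ` edges G\<rparr>"

definition complete_graph :: "nat \<Rightarrow> nat graph" where
  "complete_graph n = \<lparr>verts = {..<n}, edges = {e. e \<subseteq> {..<n} \<and> card e = 2}\<rparr>"

(* The disjoint union m G; the first component is the index of the copy. *)
definition copies :: "nat \<Rightarrow> 'a graph \<Rightarrow> (nat \<times> 'a) graph" where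
  "copies m G = \<lparr>verts = {..<m} \<times> verts G,
                 edges = (\<Union>c<m. (`) (Pair c) ` edges G)\<rparr>"

definition join :: "'a graph \<Rightarrow> 'b graph \<Rightarrow> ('a + 'b) graph" where
  "join G H = \<lparr>verts = verts G <+> verts H,
               edges = (`) Inl ` edges G \<union> (`) Inr ` edges H
                       \<union> {{Inl u, Inr v} | u v. u \<in> verts G \<and> v \<in> verts H}\<rparr>"

(* A(m K_n, K_r), for r < n and m > 0: in every copy of K_n the chosen K_r is the one on the
   vertices 0, ..., r - 1, and it is identified with the one in copy 0.  Since edges form a
   set, the m copies of an edge inside K_r become a single edge. *)
definition amalgamation :: "nat \<Rightarrow> nat \<Rightarrow> nat \<Rightarrow> (nat \<times> nat) graph" where
  "amalgamation m n r =
     map_graph (\<lambda>(c, i). if i < r then (0, i) else (c, i)) (copies m (complete_graph n))"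

definition vertex_sum :: "'a graph \<Rightarrow> ('a set \<Rightarrow> nat) \<Rightarrow> 'a \<Rightarrow> nat" where
  "vertex_sum G g u = (\<Sum>e\<in>{e \<in> edges G. u \<in> e}. g e)"

definition local_antimagic_labeling :: "'a graph \<Rightarrow> ('a set \<Rightarrow> nat) \<Rightarrow> bool" where
  "local_antimagic_labeling G g \<longleftrightarrow>
     bij_betw g (edges G) {1..card (edges G)} \<and>
     (\<forall>u v. {u, v} \<in> edges G \<longrightarrow> vertex_sum G g u \<noteq> vertex_sum G g v)"

(* On nat, Inf of a nonempty set is its minimum.  Inf {} = 0, so for a simple graph with a
   vertex the value 0 means exactly that there is no local antimagic labeling. *)
definition local_antimagic_chromatic_number :: "'a graph \<Rightarrow> nat" ("\<chi>\<^sub>l\<^sub>a") where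
  "\<chi>\<^sub>l\<^sub>a G = Inf {card (vertex_sum G g ` verts G) | g. local_antimagic_labeling G g}"

lemma simple_graph_map_graph:
  assumes "simple_graph G" and "\<And>e. e \<in> edges G \<Longrightarrow> inj_on f e"
  shows "simple_graph (map_graph f G)"
  using assms by (auto simp: simple_graph_def map_graph_def card_image)

lemma simple_graph_complete_graph: "simple_graph (complete_graph n)"
  by (simp add: simple_graph_def complete_graph_def)

lemma simple_graph_copies: "simple_graph G \<Longrightarrow> simple_graph (copies m G)"
  by (fastforce simp: simple_graph_def copies_def card_image inj_on_def)

lemma simple_graph_join:
  assumes "simple_graph G" "simple_graph H"
  shows "simple_graph (join G H)"
  using assms by (fastforce simp: simple_graph_def join_def card_image)

lemma simple_graph_amalgamation: "simple_graph (amalgamation m n r)"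
  unfolding amalgamation_def
proof (rule simple_graph_map_graph)
  show "simple_graph (copies m (complete_graph n))"
    by (intro simple_graph_copies simple_graph_complete_graph)
qed (auto simp: copies_def inj_on_def split: if_splits)

end

theory Submission
  imports Defs
begin

text \<open>
  Put \<open>k = n - 1\<close>, an even number. Both graphs consist of \<open>m\<close> pages, each a \<open>K\<^sub>k\<close>, joined to a
  spine \<open>{b, a}\<close> that is itself an edge, so that every page together with the spine is a
  \<open>K\<^bsub>k+2\<^esub>\<close>. The end vertices of an edge have different sums, so the sums on such a clique are
  pairwise distinct and at least \<open>k + 2 = n + 1\<close> values occur (\<open>card_weights_ge\<close>). It remains to
  find a labeling with only \<open>k + 2\<close> values.

  Number the vertices of a page \<open>0, \<dots>, k - 1\<close>, the spine vertices \<open>b = k\<close> and \<open>a = k + 1\<close>, and let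
  every label other than that of the spine edge be an affine function of the number \<open>c\<close> of the page,
  with a slope that depends only on the two vertex numbers \<open>i < j\<close>. The sum at vertex \<open>i\<close> of page \<open>c\<close> is then the same on all pages
  as soon as the slopes of the edges at \<open>i\<close> add up to zero. There are \<open>k + 1\<close> such edges, an odd
  number, so slopes \<open>1\<close> and \<open>-1\<close> are not enough. The spokes to \<open>a\<close> get slope \<open>2\<close>, which is possible
  without repeated labels because two such families interleave and \<open>k\<close> is even. The spokes to
  \<open>b\<close> get slope \<open>-1\<close>, and an edge inside a page gets slope \<open>1\<close> or \<open>-1\<close> according to whether \<open>i + j\<close>
  is even or odd; at each vertex the edges inside the page
  contribute \<open>(k/2 - 1) - k/2 = -1\<close>. The total is
  \<open>2 - 1 - 1 = 0\<close>.

  The constant terms decide the order of the sums. The edges of \<open>K\<^bsub>k+1\<^esub>\<close> (a page with \<open>b\<close>) take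
  consecutive blocks of \<open>m\<close> labels in colexicographic order, then come the spokes to \<open>a\<close>, and
  the spine edge gets the largest label. Replacing one end of an edge by a vertex of the
  page with a larger number moves the constant term up, so the sums within a page strictly
  increase with \<open>i\<close> (\<open>label_sum_strict_mono\<close>). A comparison label by label
  shows that the sum at \<open>b\<close> exceeds all of these and that the sum at \<open>a\<close> exceeds the one at \<open>b\<close>.
  This gives exactly \<open>k + 2\<close> values, and neighbours get different ones.
\<close>

section \<open>Bijections onto blocks of consecutive numbers\<close>

text \<open>The colexicographic rank of a pair \<open>i < j\<close>: it is preceded by the \<open>j choose 2\<close> pairs below \<open>j\<close>
  and by the \<open>i\<close> pairs with the same larger element.\<close>

lemma bij_betw_colex_rank:
  "bij_betw (\<lambda>(i, j). (j choose 2) + i) {(i, j). i < j \<and> j < n} {..<(n choose 2)}"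
proof (induction n)
  case 0
  then show ?case by (simp add: bij_betw_def numeral_2_eq_2)
next
  case (Suc n)
  have split: "{(i, j). i < j \<and> j < Suc n} = {(i, j). i < j \<and> j < n} \<union> (\<lambda>i. (i, n)) ` {..<n}"
    by auto
  have new: "bij_betw (\<lambda>(i, j). (j choose 2) + i) ((\<lambda>i. (i, n)) ` {..<n})
      {(n choose 2)..<(n choose 2) + n}"
    unfolding bij_betw_def
  proof
    show "inj_on (\<lambda>(i, j). (j choose 2) + i) ((\<lambda>i. (i, n)) ` {..<n})"
      by (auto simp: inj_on_def)
    have "(\<lambda>(i, j). (j choose 2) + i) ` (\<lambda>i. (i, n)) ` {..<n} = (+) (n choose 2) ` {0..<n}"
      by (auto simp: image_image lessThan_atLeast0)
    then show "(\<lambda>(i, j). (j choose 2) + i) ` (\<lambda>i. (i, n)) ` {..<n}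
        = {(n choose 2)..<(n choose 2) + n}"
      by (simp add: image_add_atLeastLessThan add.commute)
  qed
  have "Suc n choose 2 = (n choose 2) + n"
    by (simp add: numeral_2_eq_2)
  then have "{..<(Suc n choose 2)} = {..<(n choose 2)} \<union> {(n choose 2)..<(n choose 2) + n}"
    by auto
  moreover have "bij_betw (\<lambda>(i, j). (j choose 2) + i)
      ({(i, j). i < j \<and> j < n} \<union> (\<lambda>i. (i, n)) ` {..<n})
      ({..<(n choose 2)} \<union> {(n choose 2)..<(n choose 2) + n})"
    by (rule bij_betw_combine[OF Suc new]) auto
  ultimately show ?case by (simp only: split)
qed

text \<open>Colexicographic order is used because of this monotonicity: it makes the vertex sums inside
  a page increase with the vertex number.\<close>

lemma colex_rank_mono:
  fixes x y j :: nat
  assumes "x < y" "j \<noteq> x" "j \<noteq> y"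
  shows "(max x j choose 2) + min x j \<le> (max y j choose 2) + min y j"
proof -
  have mono: "(a choose 2) + a \<le> (b choose 2)" if "a < b" for a b :: nat
  proof -
    have "Suc a choose 2 \<le> b choose 2"
      using that by (intro binomial_right_mono) simp
    then show ?thesis by (simp add: numeral_2_eq_2)
  qed
  show ?thesis
    using assms mono[of x y] mono[of j y] by (cases "j < x"; cases "j < y") auto
qed

text \<open>Each \<open>a\<close> owns the block of \<open>m\<close> numbers at position \<open>R a\<close>; the permutation \<open>\<sigma> a\<close> is the
  order in which the pages \<open>c\<close> take the numbers of that block, upwards or downwards in the application.\<close>

lemma bij_betw_blocks:
  assumes R: "bij_betw R A {..<N}" and \<sigma>: "\<And>a. a \<in> A \<Longrightarrow> bij_betw (\<sigma> a) {..<m} {..<m}"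
  shows "bij_betw (\<lambda>(c, a). m * R a + \<sigma> a c) ({..<m} \<times> A) {..<m * N :: nat}"
proof (rule bij_betwI')
  have \<sigma>_less: "\<sigma> a c < m" if "a \<in> A" "c < m" for a c
    using \<sigma>[OF that(1)] that(2) by (auto simp: bij_betw_def)
  fix x y assume xy: "x \<in> {..<m} \<times> A" "y \<in> {..<m} \<times> A"
  obtain c a d b where [simp]: "x = (c, a)" "y = (d, b)" by fastforce
  show "((\<lambda>(c, a). m * R a + \<sigma> a c) x = (\<lambda>(c, a). m * R a + \<sigma> a c) y) = (x = y)"
  proof
    assume eq: "(\<lambda>(c, a). m * R a + \<sigma> a c) x = (\<lambda>(c, a). m * R a + \<sigma> a c) y"
    have l: "\<sigma> a c < m" "\<sigma> b d < m" using xy \<sigma>_less by auto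
    have "(m * R a + \<sigma> a c) div m = (m * R b + \<sigma> b d) div m"
      using eq by simp
    then have "R a = R b" using l by simp
    moreover from this have "\<sigma> a c = \<sigma> b d" using eq by simp
    ultimately show "x = y"
      using xy R \<sigma>[of a] by (auto simp: bij_betw_def dest: inj_onD)
  qed simp
next
  fix x assume "x \<in> {..<m} \<times> A"
  then obtain c a where x: "x = (c, a)" "c < m" "a \<in> A" by auto
  have "R a < N" "\<sigma> a c < m"
    using R \<sigma>[OF x(3)] x by (auto simp: bij_betw_def)
  then have "m * R a + \<sigma> a c < m * Suc (R a)" "m * Suc (R a) \<le> m * N"
    by (simp, intro mult_le_mono) auto
  then show "(\<lambda>(c, a). m * R a + \<sigma> a c) x \<in> {..<m * N}" using x by simp
next
  fix y assume y: "y \<in> {..<m * N}"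
  then have m: "0 < m" by (cases m) auto
  have "y div m < N" using y by (simp add: less_mult_imp_div_less mult.commute)
  then obtain a where a: "a \<in> A" "R a = y div m"
    using R by (metis bij_betw_def imageE lessThan_iff)
  moreover obtain c where "c < m" "\<sigma> a c = y mod m"
    using \<sigma>[OF a(1)] m by (metis bij_betw_def imageE lessThan_iff mod_less_divisor)
  ultimately show "\<exists>x\<in>{..<m} \<times> A. y = (\<lambda>(c, a). m * R a + \<sigma> a c) x"
    by (intro bexI[of _ "(c, a)"]) auto
qed

text \<open>The families of the even number \<open>2 h\<close> and the odd number \<open>2 h + 1\<close> share a block of length
  \<open>2 m\<close>, one on the even and one on the odd places. This makes slope \<open>2\<close> in \<open>c\<close> possible, and
  it is where an even number of families is needed.\<close>

lemma bij_betw_interleaved: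
  fixes m k :: nat
  assumes "even k"
  shows "bij_betw (\<lambda>(c, i). 2 * m * (i div 2) + 2 * c + i mod 2) ({..<m} \<times> {..<k}) {..<m * k}"
proof -
  obtain p where k: "k = 2 * p" using assms by (elim evenE)
  have inter: "bij_betw (\<lambda>(c, e). 2 * c + e) ({..<m} \<times> {..<2}) {..<2 * m}"
    by (rule bij_betw_byWitness[where f' = "\<lambda>x. (x div 2, x mod 2)"]) auto
  have shape: "bij_betw (\<lambda>(c, i). ((c, i mod 2), i div 2)) ({..<m} \<times> {..<k})
      (({..<m} \<times> {..<2}) \<times> {..<p})"
    by (rule bij_betw_byWitness[where f' = "\<lambda>((c, e), h). (c, 2 * h + e)"]) (auto simp: k)
  have blocks: "bij_betw (\<lambda>(x, h). 2 * m * h + x) ({..<2 * m} \<times> {..<p}) {..<2 * m * p}"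
    using bij_betw_blocks[of "\<lambda>h. h" "{..<p}" p "\<lambda>_ x. x" "2 * m"] by (simp add: bij_betw_def)
  have "bij_betw (map_prod (\<lambda>(c, e). 2 * c + e) (\<lambda>h. h)) (({..<m} \<times> {..<2}) \<times> {..<p})
      ({..<2 * m} \<times> {..<p})"
    by (rule bij_betw_map_prod[OF inter]) (simp add: bij_betw_def)
  from bij_betw_trans[OF bij_betw_trans[OF shape this] blocks]
  have "bij_betw (\<lambda>(c, i). 2 * m * (i div 2) + 2 * c + i mod 2) ({..<m} \<times> {..<k}) {..<2 * m * p}"
    by (rule bij_betw_cong[THEN iffD1, rotated]) auto
  then show ?thesis by (simp add: k mult.assoc mult.left_commute[of m 2])
qed

section \<open>The labels as functions of page and vertex numbers\<close>

text \<open>The label, counted from zero, of the edge between the vertices \<open>i < j\<close> of page \<open>c\<close>, where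
  \<open>k\<close> and \<open>k + 1\<close> stand for the spine vertices \<open>b\<close> and \<open>a\<close>. The value \<open>m - 1 - c\<close> gives slope \<open>-1\<close>;
  it is used for all spokes to \<open>b\<close> (\<open>j = k\<close>) and for the edges with \<open>i + j\<close> odd inside a page.\<close>

definition label :: "nat \<Rightarrow> nat \<Rightarrow> nat \<Rightarrow> nat \<Rightarrow> nat \<Rightarrow> nat" where
  "label m k c i j =
     (if j \<le> k then m * ((j choose 2) + i) + (if j < k \<and> even (i + j) then c else m - 1 - c)
      else if i < k then m * (Suc k choose 2) + (2 * m * (i div 2) + 2 * c + i mod 2)
      else m * (Suc k choose 2) + m * k)"

text \<open>The spine edge belongs to every page; listing it only with \<open>c = 0\<close> makes the indices
  correspond to the edges one to one.\<close>

definition edge_indices :: "nat \<Rightarrow> nat \<Rightarrow> (nat \<times> nat \<times> nat) set" where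
  "edge_indices m k = {(c, i, j). c < m \<and> i < j \<and> j < k + 2 \<and> (i < k \<or> c = 0)}"

lemma bij_betw_label:
  assumes "even k" "0 < m"
  shows "bij_betw (\<lambda>(c, i, j). label m k c i j) (edge_indices m k)
      {..<m * (Suc k choose 2) + m * k + 1}"
proof -
  let ?T = "Suc k choose 2" and ?f = "\<lambda>(c, i, j). label m k c i j"
  let ?A = "{..<m} \<times> {(i, j). i < j \<and> j < Suc k}"
    and ?B = "(\<lambda>(c, i). (c, i, Suc k)) ` ({..<m} \<times> {..<k})" and ?C = "{(0, k, Suc k)}"
  have A: "bij_betw ?f ?A {..<m * ?T}"
  proof -
    let ?\<sigma> = "\<lambda>(i, j) c. if j < k \<and> even (i + j) then c else m - 1 - c"
    have "bij_betw (?\<sigma> a) {..<m} {..<m}" for a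
      by (rule bij_betw_byWitness[where f' = "?\<sigma> a"]) (auto split: prod.splits)
    from bij_betw_blocks[where \<sigma> = ?\<sigma>, OF bij_betw_colex_rank[of "Suc k"] this]
    show ?thesis
      by (rule bij_betw_cong[THEN iffD1, rotated]) (auto simp: label_def)
  qed
  have B: "bij_betw ?f ?B {m * ?T..<m * ?T + m * k}"
  proof -
    let ?g = "\<lambda>(c, i). 2 * m * (i div 2) + 2 * c + i mod 2"
    have g: "bij_betw ?g ({..<m} \<times> {..<k}) {..<m * k}"
      by (rule bij_betw_interleaved[OF assms(1)])
    have shift: "bij_betw ((+) (m * ?T)) {..<m * k} {m * ?T..<m * ?T + m * k}"
      unfolding bij_betw_def by (simp add: lessThan_atLeast0 add.commute)
    have "bij_betw (\<lambda>(c, i, j). (c, i)) ?B ({..<m} \<times> {..<k})"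
      by (rule bij_betw_byWitness[where f' = "\<lambda>(c, i). (c, i, Suc k)"]) auto
    from bij_betw_trans[OF this bij_betw_trans[OF g shift]]
    show ?thesis
      by (rule bij_betw_cong[THEN iffD1, rotated]) (auto simp: label_def)
  qed
  have C: "bij_betw ?f ?C {m * ?T + m * k}"
    by (simp add: bij_betw_def label_def)
  have "edge_indices m k = ?A \<union> ?B \<union> ?C"
    using assms(2) by (auto simp: edge_indices_def less_Suc_eq image_iff)
  moreover have "{..<m * ?T + m * k + 1}
      = {..<m * ?T} \<union> {m * ?T..<m * ?T + m * k} \<union> {m * ?T + m * k}"
    by auto
  moreover have "bij_betw ?f (?A \<union> ?B \<union> ?C)
      ({..<m * ?T} \<union> {m * ?T..<m * ?T + m * k} \<union> {m * ?T + m * k})"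
    by (rule bij_betw_combine[OF bij_betw_combine[OF A B] C]) auto
  ultimately show ?thesis by simp
qed

lemma sum_alternating:
  fixes x y :: nat
  shows "(\<Sum>j<2 * p. if even (i + j) then x else y) = p * (x + y)"
proof (induction p)
  case (Suc p)
  let ?f = "\<lambda>j. if even (i + j) then x else y"
  have "2 * Suc p = Suc (Suc (2 * p))" by simp
  then have "sum ?f {..<2 * Suc p} = sum ?f {..<2 * p} + (?f (2 * p) + ?f (Suc (2 * p)))"
    by (simp only: sum.lessThan_Suc add.assoc)
  also have "?f (2 * p) + ?f (Suc (2 * p)) = x + y"
    by simp
  finally show ?case using Suc.IH by simp
qed simp

text \<open>The slopes cancel. With \<open>k = 2 * p\<close>, the alternating sum over a whole page is \<open>p * (m - 1)\<close>.
  The missing term \<open>j = i\<close> would have been \<open>c\<close>, so the edges inside the page contribute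
  \<open>p * (m - 1) - c\<close>, the spoke to \<open>b\<close> contributes \<open>m - 1 - c\<close> and the spoke to \<open>a\<close> contributes
  \<open>2 * c\<close>: the right-hand side does not contain \<open>c\<close>.\<close>

lemma label_sum_formula:
  assumes k: "k = 2 * p" and i: "i < k" and c: "c < m"
  shows "(\<Sum>j\<in>{..<k + 2} - {i}. label m k c (min i j) (max i j))
    = m * (\<Sum>j\<in>{..<k} - {i}. (max i j choose 2) + min i j) + m * ((k choose 2) + i)
      + m * (Suc k choose 2) + 2 * m * (i div 2) + i mod 2 + (p + 1) * (m - 1)"
proof -
  let ?s = "\<lambda>j. if even (i + j) then c else m - 1 - c"
  have "{..<k + 2} - {i} = insert (Suc k) (insert k ({..<k} - {i}))"
    using i by auto
  then have "(\<Sum>j\<in>{..<k + 2} - {i}. label m k c (min i j) (max i j))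
      = label m k c i (Suc k) + label m k c i k
        + (\<Sum>j\<in>{..<k} - {i}. label m k c (min i j) (max i j))"
    using i by (simp add: min_def max_def)
  also have "(\<Sum>j\<in>{..<k} - {i}. label m k c (min i j) (max i j))
      = (\<Sum>j\<in>{..<k} - {i}. m * ((max i j choose 2) + min i j) + ?s j)"
    using i by (intro sum.cong) (auto simp: label_def min_def max_def add.commute)
  also have "\<dots> = m * (\<Sum>j\<in>{..<k} - {i}. (max i j choose 2) + min i j) + sum ?s ({..<k} - {i})"
    by (subst sum.distrib) (simp only: sum_distrib_left)
  finally have eq: "(\<Sum>j\<in>{..<k + 2} - {i}. label m k c (min i j) (max i j))
      = label m k c i (Suc k) + label m k c i k
        + (m * (\<Sum>j\<in>{..<k} - {i}. (max i j choose 2) + min i j) + sum ?s ({..<k} - {i}))" .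
  have "c + sum ?s ({..<k} - {i}) = sum ?s {..<k}"
    using i by (subst sum.remove[of "{..<k}" i]) auto
  also have "\<dots> = p * (m - 1)"
    using c unfolding k by (subst sum_alternating) simp
  finally have "2 * c + (m - 1 - c) + sum ?s ({..<k} - {i}) = (p + 1) * (m - 1)"
    using c by simp
  then show ?thesis
    unfolding eq using i by (simp add: label_def)
qed

lemma label_sum_same:
  assumes "even k" "i < k" "c < m" "d < m"
  shows "(\<Sum>j\<in>{..<k + 2} - {i}. label m k c (min i j) (max i j))
    = (\<Sum>j\<in>{..<k + 2} - {i}. label m k d (min i j) (max i j))"
proof -
  obtain p where "k = 2 * p" using assms(1) by (elim evenE)
  then show ?thesis using assms by (simp only: label_sum_formula)
qed

text \<open>In the closed formula the part of each edge is monotone in the vertex number, and that of the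
  spoke to \<open>b\<close> strictly. For the spoke to \<open>a\<close> the two terms with \<open>i div 2\<close> and \<open>i mod 2\<close> have to be
  taken together.\<close>

lemma label_sum_strict_mono:
  assumes "even k" "x < y" "y < k" "c < m"
  shows "(\<Sum>j\<in>{..<k + 2} - {x}. label m k c (min x j) (max x j))
    < (\<Sum>j\<in>{..<k + 2} - {y}. label m k c (min y j) (max y j))"
proof -
  obtain p where k: "k = 2 * p" using assms(1) by (elim evenE)
  let ?r = "\<lambda>x j. (max x j choose 2) + min x j"
  let ?D = "{..<k} - {x, y}"
  \<comment> \<open>The edge between \<open>x\<close> and \<open>y\<close> occurs on both sides; the other edges are compared one by one.\<close>
  have "sum (?r x) ({..<k} - {x}) = ?r x y + sum (?r x) ?D"
    using assms by (subst sum.remove[of _ y]) (auto intro!: sum.cong)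
  also have "sum (?r x) ?D \<le> sum (?r y) ?D"
    using assms by (intro sum_mono colex_rank_mono) auto
  also have "?r x y + sum (?r y) ?D = sum (?r y) ({..<k} - {y})"
    using assms by (subst sum.remove[of "{..<k} - {y}" x]) (auto simp: min.commute max.commute intro!: sum.cong)
  finally have "m * sum (?r x) ({..<k} - {x}) \<le> m * sum (?r y) ({..<k} - {y})"
    by simp
  moreover have "m * ((k choose 2) + x) < m * ((k choose 2) + y)"
    using assms by simp
  moreover have "2 * m * (x div 2) + x mod 2 \<le> 2 * m * (y div 2) + y mod 2"
  proof (cases "x div 2 = y div 2")
    case True
    then show ?thesis using assms(2) by (metis add_le_cancel_left div_mult_mod_eq less_imp_le)
  next
    case False
    then have "Suc (x div 2) \<le> y div 2" using assms(2) by (simp add: div_le_mono order_le_neq_trans Suc_leI)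
    then have "2 * m * Suc (x div 2) \<le> 2 * m * (y div 2)" by (rule mult_le_mono2)
    moreover have "x mod 2 \<le> 2 * m" using assms(4) by (simp add: mod_less_divisor[THEN less_imp_le, THEN order_trans])
    ultimately show ?thesis by simp
  qed
  moreover have "x < k" using assms by simp
  ultimately show ?thesis
    using label_sum_formula[OF k, of x c m] label_sum_formula[OF k, of y c m] assms(3,4) by linarith
qed

section \<open>Cliques sharing an edge\<close>

text \<open>The pages and the spine, presented through an enumeration \<open>V c i\<close> of the vertices in which the
  spine vertices \<open>V c k\<close> and \<open>V c (k + 1)\<close> are the same for all pages \<open>c\<close>. Working with an
  enumeration lets both graphs of the theorem be treated at once, although their vertices have
  different types.\<close>

locale clique_book =
  fixes G :: "'a graph" and V :: "nat \<Rightarrow> nat \<Rightarrow> 'a" and m k :: nat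
  assumes verts_eq: "verts G = {V c i | c i. c < m \<and> i < k + 2}"
    and edges_eq: "edges G = {{V c i, V c j} | c i j. c < m \<and> i < k + 2 \<and> j < k + 2 \<and> i \<noteq> j}"
    and V_eq_iff: "\<lbrakk>c < m; d < m; i < k + 2; j < k + 2\<rbrakk>
      \<Longrightarrow> V c i = V d j \<longleftrightarrow> i = j \<and> (c = d \<or> k \<le> i)"
    and m_pos: "0 < m" and k_pos: "0 < k" and k_even: "even k"
begin

definition edge :: "nat \<times> nat \<times> nat \<Rightarrow> 'a set" where
  "edge = (\<lambda>(c, i, j). {V c i, V c j})"

lemma edge_ordered:
  assumes "e \<in> edges G"
  obtains c i j where "c < m" "i < j" "j < k + 2" "e = {V c i, V c j}"
proof -
  obtain c i j where "c < m" "i < k + 2" "j < k + 2" "i \<noteq> j" "e = {V c i, V c j}"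
    using assms unfolding edges_eq by blast
  then show ?thesis
    using that[of c i j] that[of c j i] by (cases "i < j") (auto simp: insert_commute)
qed

text \<open>Used to sum over the edges at \<open>u\<close>: here \<open>u\<close> comes first, whichever vertex number is smaller.\<close>

lemma edge_at:
  assumes "e \<in> edges G" "u \<in> e"
  obtains c i j where "c < m" "i < k + 2" "j < k + 2" "i \<noteq> j" "u = V c i" "e = {V c i, V c j}"
proof -
  obtain c i j where *: "c < m" "i < k + 2" "j < k + 2" "i \<noteq> j" "e = {V c i, V c j}"
    using assms(1) unfolding edges_eq by blast
  then consider "u = V c i" | "u = V c j" using assms(2) by blast
  then show ?thesis
    using that[OF *(1-4)] that[OF *(1,3,2) *(4)[symmetric]] *(5) by cases (simp_all add: insert_commute)
qed

lemma bij_betw_edge: "bij_betw edge (edge_indices m k) (edges G)"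
  unfolding bij_betw_def
proof
  show "inj_on edge (edge_indices m k)"
    by (auto simp: inj_on_def edge_def edge_indices_def doubleton_eq_iff V_eq_iff)
  show "edge ` edge_indices m k = edges G"
  proof
    show "edge ` edge_indices m k \<subseteq> edges G"
      by (fastforce simp: edge_def edge_indices_def edges_eq)
    show "edges G \<subseteq> edge ` edge_indices m k"
    proof
      fix e assume "e \<in> edges G"
      then obtain c i j where e: "c < m" "i < j" "j < k + 2" "e = {V c i, V c j}"
        by (rule edge_ordered)
      show "e \<in> edge ` edge_indices m k"
      proof (cases "i < k")
        case True
        then have "(c, i, j) \<in> edge_indices m k" using e by (simp add: edge_indices_def)
        then show ?thesis using e by (force simp: edge_def)
      next
        case False
        then have "V c i = V 0 i" "V c j = V 0 j" using e m_pos by (auto simp: V_eq_iff)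
        then have "e = edge (0, i, j)" using e by (simp add: edge_def)
        moreover have "(0, i, j) \<in> edge_indices m k" using e m_pos by (simp add: edge_indices_def)
        ultimately show ?thesis by blast
      qed
    qed
  qed
qed

definition labeling :: "'a set \<Rightarrow> nat" where
  "labeling e = (case inv_into (edge_indices m k) edge e of (c, i, j) \<Rightarrow> Suc (label m k c i j))"

lemma labeling_edge:
  assumes "c < m" "i < k" "j < k + 2" "i \<noteq> j"
  shows "labeling {V c i, V c j} = Suc (label m k c (min i j) (max i j))"
proof -
  have inj: "inj_on edge (edge_indices m k)" using bij_betw_edge by (simp add: bij_betw_def)
  have "(c, min i j, max i j) \<in> edge_indices m k"
    using assms by (auto simp: edge_indices_def)
  then have "inv_into (edge_indices m k) edge (edge (c, min i j, max i j)) = (c, min i j, max i j)"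
    by (rule inv_into_f_f[OF inj])
  moreover have "edge (c, min i j, max i j) = {V c i, V c j}"
    by (auto simp: edge_def min_def max_def)
  ultimately show ?thesis by (simp add: labeling_def)
qed

lemma labeling_spine: "labeling {V 0 k, V 0 (Suc k)} = Suc (label m k 0 k (Suc k))"
proof -
  have inj: "inj_on edge (edge_indices m k)" using bij_betw_edge by (simp add: bij_betw_def)
  have "(0, k, Suc k) \<in> edge_indices m k"
    using m_pos by (auto simp: edge_indices_def)
  then have "inv_into (edge_indices m k) edge (edge (0, k, Suc k)) = (0, k, Suc k)"
    by (rule inv_into_f_f[OF inj])
  then show ?thesis by (simp add: labeling_def edge_def)
qed

lemma bij_betw_labeling: "bij_betw labeling (edges G) {1..card (edges G)}"
proof -
  let ?q = "m * (Suc k choose 2) + m * k + 1"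
  have inv: "bij_betw (inv_into (edge_indices m k) edge) (edges G) (edge_indices m k)"
    by (rule bij_betw_inv_into[OF bij_betw_edge])
  have suc: "bij_betw Suc {..<?q} {1..?q}"
    by (simp add: bij_betw_def lessThan_atLeast0 image_Suc_atLeastLessThan atLeastLessThanSuc_atLeastAtMost)
  have "bij_betw labeling (edges G) {1..?q}"
    using bij_betw_trans[OF inv bij_betw_trans[OF bij_betw_label[OF k_even m_pos] suc]]
    by (rule bij_betw_cong[THEN iffD1, rotated]) (simp add: labeling_def case_prod_beta)
  moreover from bij_betw_same_card[OF this] have "card (edges G) = ?q" by simp
  ultimately show ?thesis by simp
qed

section \<open>Vertex sums\<close>

lemma vertex_sum_page:
  assumes "c < m" "i < k"
  shows "vertex_sum G g (V c i) = (\<Sum>j\<in>{..<k + 2} - {i}. g {V c i, V c j})"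
proof -
  have "{e \<in> edges G. V c i \<in> e} = (\<lambda>j. {V c i, V c j}) ` ({..<k + 2} - {i})"
  proof
    show "{e \<in> edges G. V c i \<in> e} \<subseteq> (\<lambda>j. {V c i, V c j}) ` ({..<k + 2} - {i})"
    proof
      fix e assume "e \<in> {e \<in> edges G. V c i \<in> e}"
      then have "e \<in> edges G" "V c i \<in> e" by auto
      then obtain d h j where e: "d < m" "h < k + 2" "j < k + 2" "h \<noteq> j" "V c i = V d h"
          "e = {V d h, V d j}"
        by (rule edge_at)
      then have "d = c" "h = i" using assms by (auto simp: V_eq_iff)
      then show "e \<in> (\<lambda>j. {V c i, V c j}) ` ({..<k + 2} - {i})" using e by auto
    qed
    show "(\<lambda>j. {V c i, V c j}) ` ({..<k + 2} - {i}) \<subseteq> {e \<in> edges G. V c i \<in> e}"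
      using assms by (fastforce simp: edges_eq)
  qed
  moreover have "inj_on (\<lambda>j. {V c i, V c j}) ({..<k + 2} - {i})"
    using assms by (auto simp: inj_on_def doubleton_eq_iff V_eq_iff)
  ultimately show ?thesis
    by (simp add: vertex_sum_def sum.reindex)
qed

lemma vertex_sum_spine:
  assumes s: "s = k \<and> t = Suc k \<or> s = Suc k \<and> t = k"
  shows "vertex_sum G g (V 0 s) = g {V 0 s, V 0 t} + (\<Sum>(c, i)\<in>{..<m} \<times> {..<k}. g {V c i, V c s})"
proof -
  let ?P = "{..<m} \<times> {..<k}" and ?e = "\<lambda>(c, i). {V c i, V c s}"
  have Vs: "V c s = V 0 s" "V c t = V 0 t" if "c < m" for c
    using that s m_pos by (auto simp: V_eq_iff)
  have "{e \<in> edges G. V 0 s \<in> e} = insert {V 0 s, V 0 t} (?e ` ?P)"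
  proof
    show "{e \<in> edges G. V 0 s \<in> e} \<subseteq> insert {V 0 s, V 0 t} (?e ` ?P)"
    proof
      fix e assume "e \<in> {e \<in> edges G. V 0 s \<in> e}"
      then have "e \<in> edges G" "V 0 s \<in> e" by auto
      then obtain c h i where *: "c < m" "h < k + 2" "i < k + 2" "h \<noteq> i" "V 0 s = V c h"
          "e = {V c h, V c i}"
        by (rule edge_at)
      then have "h = s" using s m_pos by (auto simp: V_eq_iff)
      with * have e: "c < m" "i < k + 2" "i \<noteq> s" "e = {V c i, V c s}" by auto
      show "e \<in> insert {V 0 s, V 0 t} (?e ` ?P)"
      proof (cases "i < k")
        case True
        then show ?thesis using e by auto
      next
        case False
        then have "i = t" using e s by auto
        then have "e = {V 0 s, V 0 t}" using e(4) Vs[OF e(1)] by (simp add: insert_commute)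
        then show ?thesis by simp
      qed
    qed
    have "{V 0 s, V 0 t} \<in> edges G"
      unfolding edges_eq using s m_pos by fastforce
    moreover have "?e x \<in> edges G \<and> V 0 s \<in> ?e x" if x: "x \<in> ?P" for x
    proof -
      obtain c i where ci: "x = (c, i)" "c < m" "i < k" using x by auto
      then have "{V c i, V c s} \<in> edges G" unfolding edges_eq using s by fastforce
      then show ?thesis using ci Vs(1)[OF ci(2)] by simp
    qed
    ultimately show "insert {V 0 s, V 0 t} (?e ` ?P) \<subseteq> {e \<in> edges G. V 0 s \<in> e}"
      by blast
  qed
  moreover have "inj_on ?e ?P"
    using s by (auto simp: inj_on_def doubleton_eq_iff V_eq_iff)
  moreover have "{V 0 s, V 0 t} \<notin> ?e ` ?P"
    using s m_pos by (auto simp: doubleton_eq_iff V_eq_iff)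
  ultimately show ?thesis
    by (simp add: vertex_sum_def sum.reindex case_prod_beta')
qed

abbreviation (input) weight :: "nat \<Rightarrow> nat \<Rightarrow> nat" where
  "weight c i \<equiv> vertex_sum G labeling (V c i)"

lemma weight_page:
  assumes "c < m" "i < k"
  shows "weight c i = (\<Sum>j\<in>{..<k + 2} - {i}. label m k c (min i j) (max i j)) + (k + 1)"
proof -
  have "weight c i = (\<Sum>j\<in>{..<k + 2} - {i}. Suc (label m k c (min i j) (max i j)))"
    unfolding vertex_sum_page[OF assms] using assms by (intro sum.cong) (auto simp: labeling_edge)
  also have "\<dots> = (\<Sum>j\<in>{..<k + 2} - {i}. label m k c (min i j) (max i j)) + card ({..<k + 2} - {i})"
    by (subst sum_Suc) simp
  finally show ?thesis using assms by simp
qed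

lemma weight_same: "\<lbrakk>c < m; i < k\<rbrakk> \<Longrightarrow> weight c i = weight 0 i"
  using label_sum_same[OF k_even, of i c m 0] m_pos by (simp add: weight_page)

lemma weight_strict_mono: "\<lbrakk>c < m; i < j; j < k\<rbrakk> \<Longrightarrow> weight c i < weight c j"
  using label_sum_strict_mono[OF k_even, of i j c m] by (simp add: weight_page)

lemma weight_spine:
  assumes "s = k \<or> s = Suc k"
  shows "weight 0 s = Suc (label m k 0 k (Suc k)) + (\<Sum>(c, i)\<in>{..<m} \<times> {..<k}. Suc (label m k c i s))"
proof -
  have "(\<Sum>(c, i)\<in>{..<m} \<times> {..<k}. labeling {V c i, V c s})
      = (\<Sum>(c, i)\<in>{..<m} \<times> {..<k}. Suc (label m k c i s))"
    using assms by (intro sum.cong) (auto simp: labeling_edge)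
  then show ?thesis
    using assms vertex_sum_spine[of k "Suc k" labeling] vertex_sum_spine[of "Suc k" k labeling] labeling_spine
    by (auto simp: insert_commute)
qed

text \<open>The three kinds of edges that follow each other in the order of labels: edges inside a page,
  spokes to \<open>b\<close>, spokes to \<open>a\<close>; the spine edge comes last. These comparisons separate the
  sums at the spine from the others and from each other.\<close>

lemma label_inner_less_spoke:
  assumes "c < m" "d < m" "i < j" "j < k"
  shows "label m k c i j < label m k d x k"
proof -
  have "Suc ((j choose 2) + i) \<le> Suc j choose 2"
    using assms by (simp add: numeral_2_eq_2)
  also have "\<dots> \<le> (k choose 2) + x"
    using binomial_right_mono[of "Suc j" k 2] assms by simp
  finally have "m * Suc ((j choose 2) + i) \<le> m * ((k choose 2) + x)"
    by (rule mult_le_mono2)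
  then show ?thesis using assms by (auto simp: label_def)
qed

lemma label_spoke_less_spoke:
  assumes "c < m" "x < k" "y < k"
  shows "label m k c x k < label m k c y (Suc k)"
proof -
  have "Suc ((k choose 2) + x) \<le> Suc k choose 2"
    using assms by (simp add: numeral_2_eq_2)
  then have "m * Suc ((k choose 2) + x) \<le> m * (Suc k choose 2)"
    by (rule mult_le_mono2)
  then show ?thesis using assms by (simp add: label_def)
qed

lemma label_spoke_less_spine:
  assumes "c < m" "x < k"
  shows "label m k c x (Suc k) < label m k 0 k (Suc k)"
proof -
  have "(2 * m * (x div 2) + 2 * c + x mod 2) < m * k"
    using bij_betw_interleaved[OF k_even, of m] assms by (fastforce simp: bij_betw_def)
  then show ?thesis using assms by (simp add: label_def)
qed

lemma weight_spine_less: "weight 0 k < weight 0 (Suc k)"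
proof -
  have "(\<Sum>(c, i)\<in>{..<m} \<times> {..<k}. Suc (label m k c i k))
      < (\<Sum>(c, i)\<in>{..<m} \<times> {..<k}. Suc (label m k c i (Suc k)))"
    using m_pos k_pos by (intro sum_strict_mono) (auto simp: label_spoke_less_spoke)
  then show ?thesis by (simp add: weight_spine)
qed

text \<open>The labels at a page vertex \<open>i\<close> are dominated by labels at \<open>b\<close>: the spoke to \<open>a\<close> by the spine edge,
  the edge to another vertex \<open>j\<close> of the page by the spoke from \<open>j\<close> to \<open>b\<close>; the spoke from \<open>i\<close> to \<open>b\<close> is
  common to both. So the spokes of page \<open>c\<close> alone suffice.\<close>

lemma weight_page_less_spine:
  assumes "c < m" "i < k"
  shows "weight c i < weight 0 k"
proof -
  let ?l = "\<lambda>j. Suc (label m k c (min i j) (max i j))"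
  have "{..<k + 2} - {i} = insert (Suc k) (insert k ({..<k} - {i}))"
    using assms by auto
  moreover have "weight c i = sum ?l ({..<k + 2} - {i})"
    unfolding vertex_sum_page[OF assms] using assms by (intro sum.cong) (auto simp: labeling_edge)
  ultimately have "weight c i = sum ?l (insert (Suc k) (insert k ({..<k} - {i})))"
    by (simp only:)
  also have "\<dots> = ?l (Suc k) + ?l k + sum ?l ({..<k} - {i})"
    by (simp add: add.assoc)
  also have "sum ?l ({..<k} - {i}) \<le> (\<Sum>j\<in>{..<k} - {i}. Suc (label m k c j k))"
    using assms by (intro sum_mono) (auto intro!: less_imp_le label_inner_less_spoke simp: min_def max_def)
  also have "?l (Suc k) + ?l k + \<dots> = ?l (Suc k) + (\<Sum>j<k. Suc (label m k c j k))"
    using assms sum.remove[of "{..<k}" i "\<lambda>j. Suc (label m k c j k)"] by (simp add: min_def max_def)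
  also have "\<dots> < Suc (label m k 0 k (Suc k)) + (\<Sum>j<k. Suc (label m k c j k))"
    using label_spoke_less_spine[OF assms] assms by (simp add: min_def max_def)
  also have "(\<Sum>j<k. Suc (label m k c j k)) \<le> (\<Sum>d<m. \<Sum>j<k. Suc (label m k d j k))"
    using assms by (intro member_le_sum[of c "{..<m}" "\<lambda>d. \<Sum>j<k. Suc (label m k d j k)"]) auto
  finally show ?thesis
    by (simp add: weight_spine sum.cartesian_product)
qed

section \<open>The local antimagic chromatic number of a clique book\<close>

lemma local_antimagic_labeling_labeling: "local_antimagic_labeling G labeling"
  unfolding local_antimagic_labeling_def
proof (intro conjI allI impI)
  show "bij_betw labeling (edges G) {1..card (edges G)}"
    by (rule bij_betw_labeling)
  have less: "weight c i < weight c j" if "c < m" "i < j" "j < k + 2" for c i j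
  proof -
    have hub: "weight c k = weight 0 k" "weight c (Suc k) = weight 0 (Suc k)"
      using that(1) m_pos V_eq_iff[of c 0 k k] V_eq_iff[of c 0 "Suc k" "Suc k"] by auto
    have "j < k \<or> i < k \<and> j = k \<or> i < k \<and> j = Suc k \<or> i = k \<and> j = Suc k"
      using that by arith
    then consider "j < k" | "i < k" "j = k" | "i < k" "j = Suc k" | "i = k" "j = Suc k"
      by blast
    then show ?thesis
      using that weight_strict_mono weight_page_less_spine[of c i] weight_spine_less hub
      by cases auto
  qed
  fix u v assume "{u, v} \<in> edges G"
  then obtain c i j where "c < m" "i < j" "j < k + 2" "{u, v} = {V c i, V c j}"
    by (rule edge_ordered)
  then show "vertex_sum G labeling u \<noteq> vertex_sum G labeling v"
    using less[of c i j] by (auto simp: doubleton_eq_iff)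
qed

lemma finite_verts: "finite (verts G)"
proof -
  have "verts G = (\<lambda>(c, i). V c i) ` ({..<m} \<times> {..<k + 2})"
    by (auto simp: verts_eq)
  then show ?thesis by simp
qed

text \<open>Page \<open>0\<close> together with the spine is a clique on \<open>k + 2\<close> vertices.\<close>

lemma card_weights_ge:
  assumes "local_antimagic_labeling G g"
  shows "k + 2 \<le> card (vertex_sum G g ` verts G)"
proof -
  have "inj_on (\<lambda>i. vertex_sum G g (V 0 i)) {..<k + 2}"
  proof (rule inj_onI, rule ccontr)
    fix i j assume *: "i \<in> {..<k + 2}" "j \<in> {..<k + 2}" "i \<noteq> j"
      "vertex_sum G g (V 0 i) = vertex_sum G g (V 0 j)"
    then have "{V 0 i, V 0 j} \<in> edges G"
      unfolding edges_eq using m_pos by fastforce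
    then show False using assms * by (auto simp: local_antimagic_labeling_def)
  qed
  then have "card ((\<lambda>i. vertex_sum G g (V 0 i)) ` {..<k + 2}) = k + 2"
    by (simp add: card_image)
  moreover have "(\<lambda>i. vertex_sum G g (V 0 i)) ` {..<k + 2} \<subseteq> vertex_sum G g ` verts G"
    using m_pos by (auto simp: verts_eq)
  ultimately show ?thesis
    by (metis card_mono finite_verts finite_imageI)
qed

lemma local_antimagic_chromatic_number_eq: "\<chi>\<^sub>l\<^sub>a G = k + 2"
  unfolding local_antimagic_chromatic_number_def
proof (rule cInf_eq_minimum)
  have "weight c i = weight 0 i" if "c < m" "i < k + 2" for c i
    using that weight_same[of c i] V_eq_iff[of c 0 i i] m_pos by (cases "i < k") auto
  then have "vertex_sum G labeling ` verts G \<subseteq> weight 0 ` {..<k + 2}"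
    by (auto simp: verts_eq)
  then have "card (vertex_sum G labeling ` verts G) \<le> card (weight 0 ` {..<k + 2})"
    by (intro card_mono) auto
  also have "\<dots> \<le> k + 2"
    using card_image_le[of "{..<k + 2}" "weight 0"] by simp
  finally have "card (vertex_sum G labeling ` verts G) \<le> k + 2" .
  then have "card (vertex_sum G labeling ` verts G) = k + 2"
    using card_weights_ge[OF local_antimagic_labeling_labeling] by simp
  then show "k + 2 \<in> {card (vertex_sum G g ` verts G) |g. local_antimagic_labeling G g}"
    using local_antimagic_labeling_labeling by force
next
  fix x assume "x \<in> {card (vertex_sum G g ` verts G) |g. local_antimagic_labeling G g}"
  then show "k + 2 \<le> x" using card_weights_ge by auto
qed

end

section \<open>The two graphs are clique books\<close>

lemma edges_complete_graph:
  "edges (complete_graph n) = {{i, j} | i j. i < n \<and> j < n \<and> i \<noteq> j}"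
  by (auto simp: complete_graph_def card_2_iff)

lemma verts_amalgamation:
  "verts (amalgamation m n r) = {if i < r then (0, i) else (c, i) | c i. c < m \<and> i < n}"
  by (force simp: amalgamation_def map_graph_def copies_def complete_graph_def image_iff)

lemma edges_amalgamation:
  "edges (amalgamation m n r) =
    {{if i < r then (0, i) else (c, i), if j < r then (0, j) else (c, j)}
      | c i j. c < m \<and> i < n \<and> j < n \<and> i \<noteq> j}" (is "_ = ?R")
proof -
  let ?h = "\<lambda>(c :: nat, i). if i < r then (0, i) else (c, i)"
  have "edges (amalgamation m n r)
      = (\<Union>c<m. (\<lambda>e. ?h ` Pair c ` e) ` {{i, j} | i j. i < n \<and> j < n \<and> i \<noteq> j})"
    by (simp add: amalgamation_def map_graph_def copies_def edges_complete_graph image_UN image_image)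
  also have "\<dots> = {?h ` Pair c ` {i, j} | c i j. c < m \<and> i < n \<and> j < n \<and> i \<noteq> j}"
    by blast
  also have "\<dots> = ?R"
    by (simp only: image_insert image_empty case_prod_conv)
  finally show ?thesis .
qed

text \<open>In an amalgamation the shared vertices carry the smallest numbers, whereas the labels
  are arranged for a spine with the largest ones; reversing the numbering mediates.\<close>

lemma clique_book_reverse:
  assumes verts: "verts G = {W c i | c i. c < m \<and> i < k + 2}"
    and edges: "edges G = {{W c i, W c j} | c i j. c < m \<and> i < k + 2 \<and> j < k + 2 \<and> i \<noteq> j}"
    and W: "\<And>c d i j. W c i = W d j \<longleftrightarrow> i = j \<and> (c = d \<or> i < 2)"
    and "0 < m" "0 < k" "even k"
  shows "clique_book G (\<lambda>c i. W c (k + 1 - i)) m k"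
proof
  show "verts G = {W c (k + 1 - i) | c i. c < m \<and> i < k + 2}"
    (is "_ = ?R")
  proof (intro subset_antisym subsetI)
    fix v assume "v \<in> verts G"
    then obtain c i where "c < m" "i < k + 2" "v = W c i"
      unfolding verts by blast
    then show "v \<in> ?R"
      by (intro CollectI exI[of _ c] exI[of _ "k + 1 - i"]) auto
  next
    fix v assume "v \<in> ?R"
    then obtain c i where "c < m" "i < k + 2" "v = W c (k + 1 - i)"
      by blast
    then show "v \<in> verts G"
      unfolding verts by (intro CollectI exI[of _ c] exI[of _ "k + 1 - i"]) auto
  qed
  show "edges G = {{W c (k + 1 - i), W c (k + 1 - j)} | c i j.
      c < m \<and> i < k + 2 \<and> j < k + 2 \<and> i \<noteq> j}" (is "_ = ?R")
  proof (intro subset_antisym subsetI)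
    fix e assume "e \<in> edges G"
    then obtain c i j where "c < m" "i < k + 2" "j < k + 2" "i \<noteq> j" "e = {W c i, W c j}"
      unfolding edges by blast
    then show "e \<in> ?R"
      by (intro CollectI exI[of _ c] exI[of _ "k + 1 - i"] exI[of _ "k + 1 - j"]) auto
  next
    fix e assume "e \<in> ?R"
    then obtain c i j where "c < m" "i < k + 2" "j < k + 2" "i \<noteq> j"
        "e = {W c (k + 1 - i), W c (k + 1 - j)}"
      by blast
    then show "e \<in> edges G"
      unfolding edges
      by (intro CollectI exI[of _ c] exI[of _ "k + 1 - i"] exI[of _ "k + 1 - j"]) auto
  qed
  fix c d i j :: nat
  assume "i < k + 2" "j < k + 2"
  then show "W c (k + 1 - i) = W d (k + 1 - j) \<longleftrightarrow> i = j \<and> (c = d \<or> k \<le> i)"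
    unfolding W by auto
qed (fact assms)+

lemma clique_book_amalgamation:
  assumes "0 < m" "0 < k" "even k"
  shows "clique_book (amalgamation m (k + 2) 2)
    (\<lambda>c i. if k + 1 - i < 2 then (0, k + 1 - i) else (c, k + 1 - i)) m k"
  by (rule clique_book_reverse[OF verts_amalgamation edges_amalgamation _ assms]) auto

text \<open>The apex of the join takes number \<open>0\<close>, which shifts the vertex shared by all copies of
  \<open>K\<^bsub>k+1\<^esub>\<close> to number \<open>1\<close>; together they form the spine.\<close>

lemma clique_book_join:
  assumes "0 < m" "0 < k" "even k"
  defines "W \<equiv> \<lambda>c i. if i = 0 then Inr 0 else Inl (if i - 1 < 1 then (0, i - 1) else (c, i - 1))"
  shows "clique_book (join (amalgamation m (k + 1) 1) (complete_graph 1)) (\<lambda>c i. W c (k + 1 - i)) m k"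
    (is "clique_book ?J _ _ _")
proof (rule clique_book_reverse)
  let ?h = "\<lambda>c i. if i < 1 then (0, i) else (c :: nat, i :: nat)"
  have Inl_h: "Inl (?h c i) = W c (Suc i)" for c i
    by (simp add: W_def)
  have Inr_0: "Inr 0 = W c 0" for c
    by (simp add: W_def)
  have k1: "complete_graph 1 = \<lparr>verts = {0}, edges = {}\<rparr>"
    by (auto simp: complete_graph_def card_2_iff)
  have "verts ?J = {Inr 0} \<union> Inl ` verts (amalgamation m (k + 1) 1)"
    unfolding join_def k1 by auto
  also have "\<dots> = {Inr 0} \<union> {Inl (?h c i) | c i. c < m \<and> i < k + 1}"
    unfolding verts_amalgamation by blast
  also have "\<dots> = {W 0 0} \<union> {W c (Suc i) | c i. c < m \<and> i < k + 1}"
    by (simp only: Inl_h Inr_0[of 0])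
  also have "\<dots> = {W c i | c i. c < m \<and> i < k + 2}" (is "?L = ?R")
  proof (intro subset_antisym subsetI)
    fix x assume "x \<in> ?L"
    then consider "x = W 0 0" | c i where "c < m" "Suc i < k + 2" "x = W c (Suc i)"
      by auto
    then show "x \<in> ?R"
      using assms(1) by cases fastforce+
  next
    fix x assume "x \<in> ?R"
    then obtain c i where "c < m" "i < k + 2" "x = W c i"
      by blast
    then show "x \<in> ?L"
      using Inr_0[of 0] Inr_0[of c] by (cases i) auto
  qed
  finally show "verts ?J = {W c i | c i. c < m \<and> i < k + 2}" .
  have "edges ?J = {{W c (Suc i), W c (Suc j)} | c i j. c < m \<and> i < k + 1 \<and> j < k + 1 \<and> i \<noteq> j}
      \<union> {{W c (Suc i), W c 0} | c i. c < m \<and> i < k + 1}" (is "_ = ?A \<union> ?B")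
  proof -
    have "(`) Inl ` edges (amalgamation m (k + 1) 1)
        = {Inl ` {?h c i, ?h c j} | c i j. c < m \<and> i < k + 1 \<and> j < k + 1 \<and> i \<noteq> j}"
      unfolding edges_amalgamation by blast
    also have "\<dots> = ?A"
      by (simp only: image_insert image_empty Inl_h)
    finally have A: "(`) Inl ` edges (amalgamation m (k + 1) 1) = ?A" .
    have "{{Inl u, Inr v} | u v. u \<in> verts (amalgamation m (k + 1) 1) \<and> v \<in> {0 :: nat}}
        = {{Inl (?h c i), Inr 0} | c i. c < m \<and> i < k + 1}"
      unfolding verts_amalgamation by blast
    also have "\<dots> = {{W c (Suc i), Inr 0} | c i. c < m \<and> i < k + 1}"
      by (simp only: Inl_h)
    also have "\<dots> = ?B"
      by (simp only: Inr_0[symmetric])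
    finally have B: "{{Inl u, Inr v} | u v. u \<in> verts (amalgamation m (k + 1) 1) \<and> v \<in> {0 :: nat}} = ?B" .
    have "edges ?J = (`) Inl ` edges (amalgamation m (k + 1) 1)
        \<union> {{Inl u, Inr v} | u v. u \<in> verts (amalgamation m (k + 1) 1) \<and> v \<in> {0 :: nat}}"
      unfolding join_def k1 by simp
    then show ?thesis
      unfolding A B .
  qed
  also have "\<dots> = {{W c i, W c j} | c i j. c < m \<and> i < k + 2 \<and> j < k + 2 \<and> i \<noteq> j}" (is "_ = ?R")
  proof (intro subset_antisym subsetI)
    fix e assume "e \<in> ?A \<union> ?B"
    then consider c i j where "c < m" "Suc i < k + 2" "Suc j < k + 2" "Suc i \<noteq> Suc j"
        "e = {W c (Suc i), W c (Suc j)}"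
      | c i where "c < m" "Suc i < k + 2" "e = {W c (Suc i), W c 0}"
      by auto
    then show "e \<in> ?R"
      by cases (blast, fastforce)
  next
    fix e assume "e \<in> ?R"
    then obtain c i j where e: "c < m" "i < k + 2" "j < k + 2" "i \<noteq> j" "e = {W c i, W c j}"
      by blast
    show "e \<in> ?A \<union> ?B"
    proof (cases "i = 0 \<or> j = 0")
      case True
      then obtain h where "h < k + 1" "e = {W c (Suc h), W c 0}"
        using e by (cases i; cases j) (auto simp: insert_commute)
      then show ?thesis using e(1) by blast
    next
      case False
      then obtain x y where "i = Suc x" "j = Suc y"
        by (meson not0_implies_Suc)
      then have "e \<in> ?A" using e by auto
      then show ?thesis by blast
    qed
  qed
  finally show "edges ?J = ?R" .
  show "W c i = W d j \<longleftrightarrow> i = j \<and> (c = d \<or> i < 2)" for c d i j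
    by (auto simp: W_def)
qed (fact assms)+

theorem corollary2p12:
  fixes m n :: nat
  assumes "m \<ge> 2" and "n \<ge> 3" and "odd n"
  shows "\<chi>\<^sub>l\<^sub>a (amalgamation m (n + 1) 2) = \<chi>\<^sub>l\<^sub>a (join (amalgamation m n 1) (complete_graph 1))
       \<and> \<chi>\<^sub>l\<^sub>a (join (amalgamation m n 1) (complete_graph 1)) = n + 1"
proof -
  obtain k where n: "n = k + 1" and k: "0 < k" "even k"
    using assms by (cases n) auto
  have m: "0 < m" using assms by simp
  show ?thesis
    using clique_book.local_antimagic_chromatic_number_eq[OF clique_book_amalgamation[OF m k]]
      clique_book.local_antimagic_chromatic_number_eq[OF clique_book_join[OF m k]]
    by (simp add: n)
qed

end
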